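(* Let $\mathtt{bel}:\mathscr{L}_{\mathsf{BD}}\to[0,1]$ be a function on $\mathsf{BD}$ formulas satisfying the axioms of a general belief function, i.e.: (i) if $\varphi\vdash_{\mathsf{BD}}\psi$ then $\mathtt{bel}(\varphi)\le\mathtt{bel}(\psi)$; (ii) for every $k\ge1$ and all $\varphi_1,\dots,\varphi_k\in\mathscr{L}_{\mathsf{BD}}$, $$\mathtt{bel}\Big(\bigvee_{i=1}^k\varphi_i\Big)\ \ge \sum_{\varnothing\neq J\subseteq\{1,\dots,k\}}(-1)^{|J|+1}\,\mathtt{bel}\Big(\bigwedge_{j\in J}\varphi_j\Big).$$ Then, for the canonical model $\mathscr{M}_c=\langle\mathcal P(\mathsf{Lit}),v^+_c,v^-_c\rangle$, there is a belief function $\mathtt{bel}'$ on the powerset $\mathcal P(\mathcal P(\mathsf{Lit}))$ of its set of states such that $\mathtt{bel}(\varphi)=\mathtt{bel}'(|\varphi|^+)$ for every $\varphi\in\mathscr{L}_{\mathsf{BD}}$.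
   Context: Fix a finite set $\mathtt{Prop}$ of propositional variables; $\mathscr{L}_{\mathsf{BD}}$ is the set of formulas built from $\mathtt{Prop}$ with $\neg,\wedge,\vee$, and $\mathsf{Lit}=\mathtt{Prop}\cup\{\neg p:p\in\mathtt{Prop}\}$. A BD model is $\langle W,v^+,v^-\rangle$ with $W\neq\varnothing$ and $v^+,v^-:\mathtt{Prop}\to\mathcal P(W)$; positive and negative support are defined by: $w\vDash^+p$ iff $w\in v^+(p)$; $w\vDash^-p$ iff $w\in v^-(p)$; $w\vDash^+\neg\varphi$ iff $w\vDash^-\varphi$; $w\vDash^-\neg\varphi$ iff $w\vDash^+\varphi$; $w\vDash^+\varphi\wedge\psi$ iff $w\vDash^+\varphi$ and $w\vDash^+\psi$; $w\vDash^-\varphi\wedge\psi$ iff $w\vDash^-\varphi$ or $w\vDash^-\psi$; $w\vDash^+\varphi\vee\psi$ iff $w\vDash^+\varphi$ or $w\vDash^+\psi$; $w\vDash^-\varphi\vee\psi$ iff $w\vDash^-\varphi$ and $w\vDash^-\psi$. Put $|\varphi|^\pm=\{w\in W:w\vDash^\pm\varphi\}$. $\varphi\vdash_{\mathsf{BD}}\psi$ means that in every BD model $|\varphi|^+\subseteq|\psi|^+$ and $|\psi|^-\subseteq|\varphi|^-$ (Belnap–Dunn entailment). The canonical model has state set $\mathcal P(\mathsf{Lit})$, $v^+_c(p)=\{s\subseteq\mathsf{Lit}:p\in s\}$, $v^-_c(p)=\{s\subseteq\mathsf{Lit}:\neg p\in s\}$. A belief function on a powerset $\mathcal P(S)$ is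 a monotone map $b:\mathcal P(S)\to[0,1]$ such that for all $k\ge1$ and $A_1,\dots,A_k\subseteq S$, $b(\bigcup_i A_i)\ge\sum_{\varnothing\ne J\subseteq\{1..k\}}(-1)^{|J|+1}b(\bigcap_{j\in J}A_j)$, and $b(\varnothing)=0$, $b(S)=1$. *)

theory Defs
  imports Complex_Main
begin

datatype (atoms: 'p) fm =
    Atom 'p
  | Neg "'p fm"
  | Conj "'p fm" "'p fm"
  | Disj "'p fm" "'p fm"

definition L_BD :: "'p set \<Rightarrow> 'p fm set" where
  "L_BD Prop = {\<phi>. atoms \<phi> \<subseteq> Prop}"

definition Lit :: "'p set \<Rightarrow> 'p fm set" where
  "Lit Prop = Atom ` Prop \<union> (\<lambda>p. Neg (Atom p)) ` Prop"

record ('p, 'w) model =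
  worlds :: "'w set"
  vpos :: "'p \<Rightarrow> 'w set"
  vneg :: "'p \<Rightarrow> 'w set"

definition BD_model :: "'p set \<Rightarrow> ('p, 'w) model \<Rightarrow> bool" where
  "BD_model Prop M \<longleftrightarrow>
     worlds M \<noteq> {} \<and> (\<forall>p\<in>Prop. vpos M p \<subseteq> worlds M \<and> vneg M p \<subseteq> worlds M)"

fun supp_pos :: "('p, 'w) model \<Rightarrow> 'w \<Rightarrow> 'p fm \<Rightarrow> bool"
  and supp_neg :: "('p, 'w) model \<Rightarrow> 'w \<Rightarrow> 'p fm \<Rightarrow> bool" where
  "supp_pos M w (Atom p) \<longleftrightarrow> w \<in> vpos M p"
| "supp_pos M w (Neg \<phi>) \<longleftrightarrow> supp_neg M w \<phi>"
| "supp_pos M w (Conj \<phi> \<psi>) \<longleftrightarrow> supp_pos M w \<phi> \<and> supp_pos M w \<psi>"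
| "supp_pos M w (Disj \<phi> \<psi>) \<longleftrightarrow> supp_pos M w \<phi> \<or> supp_pos M w \<psi>"
| "supp_neg M w (Atom p) \<longleftrightarrow> w \<in> vneg M p"
| "supp_neg M w (Neg \<phi>) \<longleftrightarrow> supp_pos M w \<phi>"
| "supp_neg M w (Conj \<phi> \<psi>) \<longleftrightarrow> supp_neg M w \<phi> \<or> supp_neg M w \<psi>"
| "supp_neg M w (Disj \<phi> \<psi>) \<longleftrightarrow> supp_neg M w \<phi> \<and> supp_neg M w \<psi>"

definition ext_pos :: "('p, 'w) model \<Rightarrow> 'p fm \<Rightarrow> 'w set" where
  "ext_pos M \<phi> = {w \<in> worlds M. supp_pos M w \<phi>}"

definition ext_neg :: "('p, 'w) model \<Rightarrow> 'p fm \<Rightarrow> 'w set" where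
  "ext_neg M \<phi> = {w \<in> worlds M. supp_neg M w \<phi>}"

(* A definition cannot quantify over the type of worlds, so it is fixed to nat here.
   BD_entails_iff below shows that the choice is immaterial: the same relation
   results for models over any type of worlds. *)
definition BD_entails :: "'p set \<Rightarrow> 'p fm \<Rightarrow> 'p fm \<Rightarrow> bool" where
  "BD_entails Prop \<phi> \<psi> \<longleftrightarrow>
     (\<forall>M :: ('p, nat) model. BD_model Prop M \<longrightarrow>
        ext_pos M \<phi> \<subseteq> ext_pos M \<psi> \<and> ext_neg M \<psi> \<subseteq> ext_neg M \<phi>)"

lemma BD_entails_transfer:
  fixes M :: "('p, 'w) model" and u :: 'u
  assumes ent: "\<And>N :: ('p, 'u) model. BD_model Prop N \<Longrightarrow>
      ext_pos N \<phi> \<subseteq> ext_pos N \<psi> \<and> ext_neg N \<psi> \<subseteq> ext_neg N \<phi>"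
  shows "ext_pos M \<phi> \<subseteq> ext_pos M \<psi> \<and> ext_neg M \<psi> \<subseteq> ext_neg M \<phi>"
proof -
  have *: "(supp_pos M w \<phi> \<longrightarrow> supp_pos M w \<psi>) \<and> (supp_neg M w \<psi> \<longrightarrow> supp_neg M w \<phi>)" for w
  proof -
    define N :: "('p, 'u) model" where
      "N = \<lparr>worlds = {u}, vpos = (\<lambda>p. if w \<in> vpos M p then {u} else {}),
                          vneg = (\<lambda>p. if w \<in> vneg M p then {u} else {})\<rparr>"
    have "BD_model Prop N" by (simp add: N_def BD_model_def)
    moreover have "supp_pos N u \<chi> = supp_pos M w \<chi> \<and> supp_neg N u \<chi> = supp_neg M w \<chi>" for \<chi>
      by (induction \<chi>) (auto simp: N_def)
    moreover have "worlds N = {u}" by (simp add: N_def)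
    ultimately show ?thesis using ent[of N] by (auto simp: ext_pos_def ext_neg_def)
  qed
  then show ?thesis by (auto simp: ext_pos_def ext_neg_def)
qed

lemma BD_entails_iff:
  "BD_entails Prop \<phi> \<psi> \<longleftrightarrow>
     (\<forall>M :: ('p, 'w) model. BD_model Prop M \<longrightarrow>
        ext_pos M \<phi> \<subseteq> ext_pos M \<psi> \<and> ext_neg M \<psi> \<subseteq> ext_neg M \<phi>)"
  unfolding BD_entails_def
  using BD_entails_transfer[where ?'u = nat and ?'w = 'w and Prop = Prop and \<phi> = \<phi> and \<psi> = \<psi>]
    BD_entails_transfer[where ?'u = 'w and ?'w = nat and Prop = Prop and \<phi> = \<phi> and \<psi> = \<psi>]
  by blast

definition canonical_model :: "'p set \<Rightarrow> ('p, 'p fm set) model" where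
  "canonical_model Prop =
     \<lparr>worlds = Pow (Lit Prop),
      vpos = (\<lambda>p. {s. s \<subseteq> Lit Prop \<and> Atom p \<in> s}),
      vneg = (\<lambda>p. {s. s \<subseteq> Lit Prop \<and> Neg (Atom p) \<in> s})\<rparr>"

lemma BD_model_canonical: "BD_model Prop (canonical_model Prop)"
  by (auto simp: BD_model_def canonical_model_def)

(* L_BD has no constants, so these are meaningful for nonempty lists only. *)
fun conj_list :: "'p fm list \<Rightarrow> 'p fm" where
  "conj_list [\<phi>] = \<phi>"
| "conj_list (\<phi> # \<psi> # \<phi>s) = Conj \<phi> (conj_list (\<psi> # \<phi>s))"

fun disj_list :: "'p fm list \<Rightarrow> 'p fm" where
  "disj_list [\<phi>] = \<phi>"
| "disj_list (\<phi> # \<psi> # \<phi>s) = Disj \<phi> (disj_list (\<psi> # \<phi>s))"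

(* Indices are taken in increasing order; for a finite nonempty set of indices the order and
   the bracketing do not matter up to BD-equivalence. *)
definition BigConj :: "(nat \<Rightarrow> 'p fm) \<Rightarrow> nat set \<Rightarrow> 'p fm" where
  "BigConj \<phi> J = conj_list (map \<phi> (sorted_list_of_set J))"

definition BigDisj :: "(nat \<Rightarrow> 'p fm) \<Rightarrow> nat set \<Rightarrow> 'p fm" where
  "BigDisj \<phi> J = disj_list (map \<phi> (sorted_list_of_set J))"

definition general_belief :: "'p set \<Rightarrow> ('p fm \<Rightarrow> real) \<Rightarrow> bool" where
  "general_belief Prop bel \<longleftrightarrow>
     (\<forall>\<phi>\<in>L_BD Prop. bel \<phi> \<in> {0..1}) \<and>
     (\<forall>\<phi>\<in>L_BD Prop. \<forall>\<psi>\<in>L_BD Prop. BD_entails Prop \<phi> \<psi> \<longrightarrow> bel \<phi> \<le> bel \<psi>) \<and>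
     (\<forall>k\<ge>1. \<forall>\<phi> :: nat \<Rightarrow> 'p fm. (\<forall>i\<in>{1..k}. \<phi> i \<in> L_BD Prop) \<longrightarrow>
        bel (BigDisj \<phi> {1..k}) \<ge>
          (\<Sum>J\<in>{J. J \<noteq> {} \<and> J \<subseteq> {1..k}}. (-1) ^ (card J + 1) * bel (BigConj \<phi> J)))"

definition belief_function :: "'s set \<Rightarrow> ('s set \<Rightarrow> real) \<Rightarrow> bool" where
  "belief_function S b \<longleftrightarrow>
     (\<forall>A\<in>Pow S. b A \<in> {0..1}) \<and>
     (\<forall>A\<in>Pow S. \<forall>B\<in>Pow S. A \<subseteq> B \<longrightarrow> b A \<le> b B) \<and>
     (\<forall>k\<ge>1. \<forall>A :: nat \<Rightarrow> 's set. (\<forall>i\<in>{1..k}. A i \<subseteq> S) \<longrightarrow>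
        b (\<Union>i\<in>{1..k}. A i) \<ge>
          (\<Sum>J\<in>{J. J \<noteq> {} \<and> J \<subseteq> {1..k}}. (-1) ^ (card J + 1) * b (\<Inter>j\<in>J. A j))) \<and>
     b {} = 0 \<and> b S = 1"

end

(* Every extension in the canonical model contains the state Lit but not the state {}, and
   extensions form a finite lattice L under union and intersection on which bel induces a totally
   monotone function, because inclusion of extensions in the canonical model already implies
   Belnap-Dunn entailment. Total monotonicity says that the Moebius inverse of this function is
   nonnegative on L; putting the missing mass 1 - bel(max L) on the full state set, which is not
   in L, gives the mass function of the required belief function. *)
theory Submission
  imports Defs
begin

section \<open>Inclusion-exclusion and belief functions given by a mass function\<close>

text \<open>Inclusion-exclusion for the additive set function \<open>sum m\<close>, applied to the
  families of those \<open>V\<close> in \<open>N\<close> that lie below \<open>A i\<close>. It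
  serves both to verify the belief inequalities and to invert \<open>f\<close> on the
  lattice.\<close>

lemma sum_subsets_inclusion_exclusion:
  fixes m :: "'a set \<Rightarrow> real"
  assumes "finite N" and "finite I"
  shows "(\<Sum>V | V \<in> N \<and> (\<exists>i\<in>I. V \<subseteq> A i). m V) =
    (\<Sum>J | J \<noteq> {} \<and> J \<subseteq> I. (-1) ^ (card J + 1) * (\<Sum>V | V \<in> N \<and> V \<subseteq> (\<Inter>j\<in>J. A j). m V))"
proof -
  interpret Incl_Excl finite "sum m"
    by unfold_locales (auto simp: sum.union_disjoint disjnt_def)
  let ?X = "\<lambda>i. {V \<in> N. V \<subseteq> A i}"
  have "sum m (\<Union>(?X ` I)) =
      (\<Sum>J | J \<subseteq> I \<and> J \<noteq> {}. (-1) ^ (card J + 1) * sum m (\<Inter>(?X ` J)))"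
    using assms by (intro restricted_indexed) auto
  moreover have "\<Union>(?X ` I) = {V \<in> N. \<exists>i\<in>I. V \<subseteq> A i}"
    by auto
  moreover have "(\<Sum>J | J \<subseteq> I \<and> J \<noteq> {}. (-1) ^ (card J + 1) * sum m (\<Inter>(?X ` J))) =
      (\<Sum>J | J \<noteq> {} \<and> J \<subseteq> I. (-1) ^ (card J + 1) * (\<Sum>V | V \<in> N \<and> V \<subseteq> (\<Inter>j\<in>J. A j). m V))"
  proof (rule sum.cong)
    fix J assume "J \<in> {J. J \<noteq> {} \<and> J \<subseteq> I}"
    \<comment> \<open>Nonemptiness of \<open>J\<close> keeps the intersection inside
      \<open>N\<close>.\<close>
    then have "\<Inter>(?X ` J) = {V \<in> N. V \<subseteq> (\<Inter>j\<in>J. A j)}"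
      by blast
    then show "(-1) ^ (card J + 1) * sum m (\<Inter>(?X ` J)) =
        (-1) ^ (card J + 1) * (\<Sum>V | V \<in> N \<and> V \<subseteq> (\<Inter>j\<in>J. A j). m V)"
      by simp
  qed auto
  ultimately show ?thesis by simp
qed

text \<open>Each alternating sum equals the mass of those \<open>V\<close> lying below a single
  \<open>A i\<close>. All of these lie below the union of the \<open>A i\<close>, so nonnegative
  masses give the inequality.\<close>

lemma belief_function_mass:
  fixes m :: "'s set \<Rightarrow> real"
  assumes fin: "finite N" and N: "N \<subseteq> Pow S" "{} \<notin> N"
    and nonneg: "\<And>V. V \<in> N \<Longrightarrow> m V \<ge> 0" and total: "sum m N = 1"
  shows "belief_function S (\<lambda>A. \<Sum>V | V \<in> N \<and> V \<subseteq> A. m V)"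
proof -
  let ?b = "\<lambda>A. \<Sum>V | V \<in> N \<and> V \<subseteq> A. m V"
  have mono: "sum m X \<le> sum m Y" if "X \<subseteq> Y" "Y \<subseteq> N" for X Y
    using that fin nonneg by (intro sum_mono2) (auto dest: finite_subset)
  have "?b A \<in> {0..1}" for A
    using mono[of "{V \<in> N. V \<subseteq> A}" N] nonneg total by (auto intro: sum_nonneg)
  moreover have "?b A \<le> ?b B" if "A \<subseteq> B" for A B
    using that by (intro mono) auto
  moreover have "?b (\<Union>i\<in>{1..k}. A i) \<ge>
      (\<Sum>J\<in>{J. J \<noteq> {} \<and> J \<subseteq> {1..k}}. (-1) ^ (card J + 1) * ?b (\<Inter>j\<in>J. A j))"
    for k :: nat and A :: "nat \<Rightarrow> 's set"
    unfolding sum_subsets_inclusion_exclusion[OF fin finite_atLeastAtMost, symmetric]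
    by (intro mono) auto
  moreover have "{V \<in> N. V \<subseteq> {}} = {}" "{V \<in> N. V \<subseteq> S} = N"
    using N by auto
  then have "?b {} = 0" "?b S = 1"
    using total by (simp_all only: sum.empty)
  ultimately show ?thesis
    unfolding belief_function_def by (intro conjI ballI allI impI) simp_all
qed

section \<open>Moebius inversion on a finite lattice of sets\<close>

lemma Inter_closed:
  assumes "\<And>U V. U \<in> L \<Longrightarrow> V \<in> L \<Longrightarrow> U \<inter> V \<in> L"
    and "finite F" "F \<noteq> {}" "F \<subseteq> L"
  shows "\<Inter>F \<in> L"
  using assms(2-) by (induction F rule: finite_ne_induct) (auto intro: assms(1))

lemma Union_closed:
  assumes "\<And>U V. U \<in> L \<Longrightarrow> V \<in> L \<Longrightarrow> U \<union> V \<in> L"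
    and "finite F" "F \<noteq> {}" "F \<subseteq> L"
  shows "\<Union>F \<in> L"
  using assms(2-) by (induction F rule: finite_ne_induct) (auto intro: assms(1))

text \<open>The mass of \<open>U\<close> is the part of \<open>f U\<close> not accounted for by the
  elements of \<open>L\<close> strictly below \<open>U\<close>, whose contribution is given by
  inclusion-exclusion. Total monotonicity bounds that contribution by \<open>f\<close> of their
  union, hence by \<open>f U\<close>.\<close>

lemma totally_monotone_nonneg_mass:
  fixes f :: "'s set \<Rightarrow> real"
  assumes fin: "finite L"
    and Int: "\<And>U V. U \<in> L \<Longrightarrow> V \<in> L \<Longrightarrow> U \<inter> V \<in> L"
    and Un: "\<And>U V. U \<in> L \<Longrightarrow> V \<in> L \<Longrightarrow> U \<union> V \<in> L"
    and nonneg: "\<And>U. U \<in> L \<Longrightarrow> f U \<ge> 0"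
    and mono: "\<And>U V. U \<in> L \<Longrightarrow> V \<in> L \<Longrightarrow> U \<subseteq> V \<Longrightarrow> f U \<le> f V"
    and total: "\<And>F. F \<subseteq> L \<Longrightarrow> F \<noteq> {} \<Longrightarrow>
      f (\<Union>F) \<ge> (\<Sum>J | J \<noteq> {} \<and> J \<subseteq> F. (-1) ^ (card J + 1) * f (\<Inter>J))"
  obtains m where "\<And>U. U \<in> L \<Longrightarrow> m U \<ge> 0"
    and "\<And>U. U \<in> L \<Longrightarrow> f U = (\<Sum>V | V \<in> L \<and> V \<subseteq> U. m V)"
proof
  let ?B = "\<lambda>U. {V \<in> L. V \<subset> U}"
  let ?m = "\<lambda>U. f U - (\<Sum>J | J \<noteq> {} \<and> J \<subseteq> ?B U. (-1) ^ (card J + 1) * f (\<Inter>J))"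
  show "?m U \<ge> 0" if U: "U \<in> L" for U
  proof (cases "?B U = {}")
    \<comment> \<open>For a minimal \<open>U\<close> the union of the elements below it is
      \<open>{}\<close>, which may lie outside \<open>L\<close>; nonnegativity of \<open>f\<close>
      is used instead.\<close>
    case True
    then have "{J. J \<noteq> {} \<and> J \<subseteq> ?B U} = {}"
      by blast
    then show ?thesis
      using nonneg[OF U] by (simp only: sum.empty)
  next
    case False
    have "(\<Sum>J | J \<noteq> {} \<and> J \<subseteq> ?B U. (-1) ^ (card J + 1) * f (\<Inter>J)) \<le> f (\<Union>(?B U))"
      using False by (intro total) auto
    also have "\<dots> \<le> f U"
      using fin False U by (intro mono Union_closed Un) auto
    finally show ?thesis by simp
  qed
  show "f U = (\<Sum>V | V \<in> L \<and> V \<subseteq> U. ?m V)" if "U \<in> L" for U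
    using that
  proof (induction "card (?B U)" arbitrary: U rule: less_induct)
    case less
    have finB: "finite (?B U)"
      using fin by simp
    have IH: "f V = (\<Sum>W | W \<in> L \<and> W \<subseteq> V. ?m W)" if "V \<in> ?B U" for V
    proof (rule less.hyps)
      show "card (?B V) < card (?B U)"
        using that by (intro psubset_card_mono finB) blast
    qed (use that in auto)
    have "(\<Sum>V | V \<in> L \<and> V \<subseteq> U. ?m V) = (\<Sum>V \<in> insert U (?B U). ?m V)"
      by (rule sum.cong) (use less.prems in auto)
    also have "\<dots> = ?m U + (\<Sum>V \<in> ?B U. ?m V)"
      using finB by (subst sum.insert) auto
    \<comment> \<open>Each \<open>V\<close> strictly below \<open>U\<close> is its own witness
      \<open>W\<close>; this brings the sum into the form required by inclusion-exclusion.\<close>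
    also have "(\<Sum>V \<in> ?B U. ?m V) = (\<Sum>V | V \<in> L \<and> (\<exists>W\<in>?B U. V \<subseteq> W). ?m V)"
      by (rule sum.cong) auto
    also have "\<dots> = (\<Sum>J | J \<noteq> {} \<and> J \<subseteq> ?B U.
        (-1) ^ (card J + 1) * (\<Sum>V | V \<in> L \<and> V \<subseteq> (\<Inter>W\<in>J. W). ?m V))"
      by (rule sum_subsets_inclusion_exclusion[OF fin finB])
    also have "\<dots> = (\<Sum>J | J \<noteq> {} \<and> J \<subseteq> ?B U. (-1) ^ (card J + 1) * f (\<Inter>J))"
    proof (rule sum.cong[OF refl])
      fix J assume "J \<in> {J. J \<noteq> {} \<and> J \<subseteq> ?B U}"
      then have J: "J \<noteq> {}" "J \<subseteq> ?B U" by auto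
      moreover have "\<Inter>J \<in> L"
        using J finB by (intro Inter_closed Int) (auto dest: finite_subset)
      \<comment> \<open>A nonempty intersection of elements strictly below \<open>U\<close> is again
        one, so the induction hypothesis evaluates the inner sum.\<close>
      ultimately have "\<Inter>J \<in> ?B U" by blast
      from IH[OF this]
      show "(-1) ^ (card J + 1) * (\<Sum>V | V \<in> L \<and> V \<subseteq> (\<Inter>W\<in>J. W). ?m V) =
          (-1) ^ (card J + 1) * f (\<Inter>J)"
        by simp
    qed
    finally show ?case by simp
  qed
qed

section \<open>Extensions of finite conjunctions and disjunctions\<close>

lemma supp_conj_list:
  "\<phi>s \<noteq> [] \<Longrightarrow> supp_pos M w (conj_list \<phi>s) \<longleftrightarrow> (\<forall>\<phi>\<in>set \<phi>s. supp_pos M w \<phi>)"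
  by (induction \<phi>s rule: conj_list.induct) auto

lemma supp_disj_list:
  "\<phi>s \<noteq> [] \<Longrightarrow> supp_pos M w (disj_list \<phi>s) \<longleftrightarrow> (\<exists>\<phi>\<in>set \<phi>s. supp_pos M w \<phi>)"
  by (induction \<phi>s rule: disj_list.induct) auto

lemma conj_list_in_L_BD:
  "\<phi>s \<noteq> [] \<Longrightarrow> set \<phi>s \<subseteq> L_BD Prop \<Longrightarrow> conj_list \<phi>s \<in> L_BD Prop"
  by (induction \<phi>s rule: conj_list.induct) (auto simp: L_BD_def)

lemma disj_list_in_L_BD:
  "\<phi>s \<noteq> [] \<Longrightarrow> set \<phi>s \<subseteq> L_BD Prop \<Longrightarrow> disj_list \<phi>s \<in> L_BD Prop"
  by (induction \<phi>s rule: disj_list.induct) (auto simp: L_BD_def)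

lemma ext_pos_BigConj:
  assumes "finite J" "J \<noteq> {}"
  shows "ext_pos M (BigConj \<phi> J) = (\<Inter>j\<in>J. ext_pos M (\<phi> j))"
  using assms by (auto simp: ext_pos_def BigConj_def supp_conj_list)

lemma ext_pos_BigDisj:
  assumes "finite J" "J \<noteq> {}"
  shows "ext_pos M (BigDisj \<phi> J) = (\<Union>j\<in>J. ext_pos M (\<phi> j))"
  using assms by (auto simp: ext_pos_def BigDisj_def supp_disj_list)

lemma BigConj_in_L_BD:
  assumes "finite J" "J \<noteq> {}" "\<And>j. j \<in> J \<Longrightarrow> \<phi> j \<in> L_BD Prop"
  shows "BigConj \<phi> J \<in> L_BD Prop"
  using assms by (auto simp: BigConj_def intro!: conj_list_in_L_BD)

lemma BigDisj_in_L_BD: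
  assumes "finite J" "J \<noteq> {}" "\<And>j. j \<in> J \<Longrightarrow> \<phi> j \<in> L_BD Prop"
  shows "BigDisj \<phi> J \<in> L_BD Prop"
  using assms by (auto simp: BigDisj_def intro!: disj_list_in_L_BD)

section \<open>Extreme states and completeness of the canonical model\<close>

text \<open>There are no constants, and the connectives preserve the value "both". Hence no
  extension is empty, as mass on \<open>{}\<close> would be forbidden.\<close>

lemma supp_canonical_top:
  assumes "atoms \<phi> \<subseteq> Prop"
  shows "supp_pos (canonical_model Prop) (Lit Prop) \<phi> \<and>
    supp_neg (canonical_model Prop) (Lit Prop) \<phi>"
  using assms by (induction \<phi>) (auto simp: canonical_model_def Lit_def)

text \<open>The value "neither" is preserved likewise. Hence no extension is the full state set,
  which stays free for the missing mass.\<close>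

lemma supp_canonical_bot:
  "\<not> supp_pos (canonical_model Prop) {} \<phi> \<and> \<not> supp_neg (canonical_model Prop) {} \<phi>"
  by (induction \<phi>) (auto simp: canonical_model_def)

text \<open>Positive support at \<open>w\<close> is copied by one canonical state, and failure of
  negative support at \<open>w\<close> by another. Through the second state and contraposition,
  inclusion of positive extensions alone also yields the condition on negative ones.\<close>

lemma canonical_subset_imp_entails:
  fixes \<phi> \<psi> :: "'p fm"
  assumes sub: "ext_pos (canonical_model Prop) \<phi> \<subseteq> ext_pos (canonical_model Prop) \<psi>"
    and L: "\<phi> \<in> L_BD Prop" "\<psi> \<in> L_BD Prop"
  shows "BD_entails Prop \<phi> \<psi>"
  unfolding BD_entails_def
proof (intro allI impI)
  fix M :: "('p, nat) model"
  have transfer: "supp_pos (canonical_model Prop) s \<psi>"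
    if "s \<subseteq> Lit Prop" "supp_pos (canonical_model Prop) s \<phi>" for s
    using sub that by (auto simp: ext_pos_def canonical_model_def)
  have "supp_pos M w \<psi>" if "supp_pos M w \<phi>" for w
  proof -
    \<comment> \<open>The literals supported at \<open>w\<close> form a canonical state with the
      same positive and negative support as \<open>w\<close>.\<close>
    define s where "s = {l \<in> Lit Prop. supp_pos M w l}"
    have "(supp_pos (canonical_model Prop) s \<chi> \<longleftrightarrow> supp_pos M w \<chi>) \<and>
        (supp_neg (canonical_model Prop) s \<chi> \<longleftrightarrow> supp_neg M w \<chi>)"
      if "atoms \<chi> \<subseteq> Prop" for \<chi>
      using that by (induction \<chi>) (auto simp: canonical_model_def s_def Lit_def)
    then show ?thesis
      using transfer[of s] that L by (auto simp: s_def L_BD_def)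
  qed
  moreover have "supp_neg M w \<phi>" if "supp_neg M w \<psi>" for w
  proof -
    \<comment> \<open>The Routley dual of \<open>w\<close>: it supports exactly the formulas whose negation \<open>w\<close> does not.\<close>
    define s where "s = {l \<in> Lit Prop. \<not> supp_neg M w l}"
    have "(supp_pos (canonical_model Prop) s \<chi> \<longleftrightarrow> \<not> supp_neg M w \<chi>) \<and>
        (supp_neg (canonical_model Prop) s \<chi> \<longleftrightarrow> \<not> supp_pos M w \<chi>)"
      if "atoms \<chi> \<subseteq> Prop" for \<chi>
      using that by (induction \<chi>) (auto simp: canonical_model_def s_def Lit_def)
    then show ?thesis
      using transfer[of s] that L by (auto simp: s_def L_BD_def)
  qed
  ultimately show "ext_pos M \<phi> \<subseteq> ext_pos M \<psi> \<and> ext_neg M \<psi> \<subseteq> ext_neg M \<phi>"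
    by (auto simp: ext_pos_def ext_neg_def)
qed

section \<open>Transfer of \<open>bel\<close> to the lattice of extensions and completion of the
  mass\<close>

theorem mainTheorem1:
  fixes Prop :: "'p set" and bel :: "'p fm \<Rightarrow> real"
  assumes "finite Prop"
    and "general_belief Prop bel"
  shows "\<exists>bel' :: 'p fm set set \<Rightarrow> real.
           belief_function (worlds (canonical_model Prop)) bel' \<and>
           (\<forall>\<phi>\<in>L_BD Prop. bel \<phi> = bel' (ext_pos (canonical_model Prop) \<phi>))"
proof -
  define ext where "ext = ext_pos (canonical_model Prop)"
  define S where "S = worlds (canonical_model Prop)"
  define L where "L = ext ` L_BD Prop"
  \<comment> \<open>\<open>inv_into\<close> picks some formula with extension \<open>U\<close>;
    \<open>f_ext\<close> shows that \<open>bel\<close> does not depend on the choice.\<close>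
  define f where "f U = bel (inv_into (L_BD Prop) ext U)" for U
  have S: "S = Pow (Lit Prop)"
    by (simp add: S_def canonical_model_def)
  have finS: "finite S"
    using assms(1) by (simp add: S Lit_def)
  have L: "L \<subseteq> Pow S" "{} \<notin> L" "S \<notin> L"
    using supp_canonical_top[of _ Prop] supp_canonical_bot[of Prop]
    by (auto simp: L_def ext_def ext_pos_def L_BD_def S_def canonical_model_def)
  have finL: "finite L"
    using L(1) finS by (auto dest: finite_subset)
  have bel_range: "bel \<phi> \<in> {0..1}" if "\<phi> \<in> L_BD Prop" for \<phi>
    using assms(2) that unfolding general_belief_def by blast
  have bel_mono: "bel \<phi> \<le> bel \<psi>"
    if "ext \<phi> \<subseteq> ext \<psi>" "\<phi> \<in> L_BD Prop" "\<psi> \<in> L_BD Prop" for \<phi> \<psi>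
    using assms(2) that canonical_subset_imp_entails[of Prop \<phi> \<psi>]
    unfolding general_belief_def ext_def by blast
  have bel_total: "bel (BigDisj \<phi> {1..k}) \<ge>
      (\<Sum>J | J \<noteq> {} \<and> J \<subseteq> {1..k}. (-1) ^ (card J + 1) * bel (BigConj \<phi> J))"
    if "k \<ge> 1" "\<And>i. i \<in> {1..k} \<Longrightarrow> \<phi> i \<in> L_BD Prop" for k and \<phi> :: "nat \<Rightarrow> 'p fm"
    using assms(2) that unfolding general_belief_def by blast
  have repr: "ext (inv_into (L_BD Prop) ext U) = U" "inv_into (L_BD Prop) ext U \<in> L_BD Prop"
    if "U \<in> L" for U
    using that unfolding L_def by (rule f_inv_into_f, rule inv_into_into)
  have f_ext: "f (ext \<phi>) = bel \<phi>" if "\<phi> \<in> L_BD Prop" for \<phi>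
    unfolding f_def using that repr[of "ext \<phi>"]
    by (intro antisym bel_mono) (auto simp: L_def)
  have f_range: "f U \<in> {0..1}" if "U \<in> L" for U
    using that bel_range f_ext by (auto simp: L_def)
  then have f_nonneg: "f U \<ge> 0" if "U \<in> L" for U
    using that by simp
  have Int: "U \<inter> V \<in> L" if UV: "U \<in> L" "V \<in> L" for U V
  proof -
    obtain \<phi> \<psi> where "\<phi> \<in> L_BD Prop" "\<psi> \<in> L_BD Prop" "U = ext \<phi>" "V = ext \<psi>"
      using UV by (auto simp: L_def)
    then have "Conj \<phi> \<psi> \<in> L_BD Prop" "U \<inter> V = ext (Conj \<phi> \<psi>)"
      by (auto simp: L_BD_def ext_def ext_pos_def)
    then show ?thesis by (simp add: L_def)
  qed
  have Un: "U \<union> V \<in> L" if UV: "U \<in> L" "V \<in> L" for U V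
  proof -
    obtain \<phi> \<psi> where "\<phi> \<in> L_BD Prop" "\<psi> \<in> L_BD Prop" "U = ext \<phi>" "V = ext \<psi>"
      using UV by (auto simp: L_def)
    then have "Disj \<phi> \<psi> \<in> L_BD Prop" "U \<union> V = ext (Disj \<phi> \<psi>)"
      by (auto simp: L_BD_def ext_def ext_pos_def)
    then show ?thesis by (simp add: L_def)
  qed
  have f_mono: "f U \<le> f V" if "U \<in> L" "V \<in> L" "U \<subseteq> V" for U V
    unfolding f_def using that by (intro bel_mono) (simp_all add: repr)
  have f_total: "f (\<Union>F) \<ge> (\<Sum>J | J \<noteq> {} \<and> J \<subseteq> F. (-1) ^ (card J + 1) * f (\<Inter>J))"
    if F: "F \<subseteq> L" "F \<noteq> {}" for F
  proof -
    have finF: "finite F"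
      using F(1) finL by (rule finite_subset)
    \<comment> \<open>The axiom for \<open>bel\<close> speaks of indexed formulas,
      \<open>f_total\<close> of sets of extensions. A repetition-free enumeration of
      \<open>F\<close> translates one into the other, preserving cardinalities and thus
      signs.\<close>
    obtain h where h: "bij_betw h {1..card F} F"
      using ex_bij_betw_nat_finite_1[OF finF] by blast
    define \<phi> where "\<phi> i = inv_into (L_BD Prop) ext (h i)" for i
    have k: "card F \<ge> 1" "{1..card F} \<noteq> {}"
      using finF F(2) card_gt_0_iff[of F] by (auto simp: Suc_le_eq)
    have \<phi>: "\<phi> i \<in> L_BD Prop" "ext (\<phi> i) = h i" if "i \<in> {1..card F}" for i
    proof -
      have "h i \<in> L"
        using that F(1) bij_betwE[OF h] by blast
      then show "\<phi> i \<in> L_BD Prop" "ext (\<phi> i) = h i"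
        by (simp_all add: \<phi>_def repr)
    qed
    have "bij_betw (image h) (Pow {1..card F} - {{}}) (Pow F - {{}})"
      using bij_betw_image_Pow[OF h] by (rule bij_betw_DiffI) (auto simp: bij_betw_def)
    then have bij: "bij_betw (image h) {J. J \<noteq> {} \<and> J \<subseteq> {1..card F}} {J. J \<noteq> {} \<and> J \<subseteq> F}"
      by (simp add: Pow_def set_diff_eq conj_commute)
    have "(\<Sum>J | J \<noteq> {} \<and> J \<subseteq> F. (-1) ^ (card J + 1) * f (\<Inter>J)) =
        (\<Sum>J | J \<noteq> {} \<and> J \<subseteq> {1..card F}. (-1) ^ (card (h ` J) + 1) * f (\<Inter>(h ` J)))"
      by (rule sum.reindex_bij_betw[OF bij, symmetric])
    also have "\<dots> =
        (\<Sum>J | J \<noteq> {} \<and> J \<subseteq> {1..card F}. (-1) ^ (card J + 1) * bel (BigConj \<phi> J))"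
    proof (rule sum.cong[OF refl])
      fix J assume "J \<in> {J. J \<noteq> {} \<and> J \<subseteq> {1..card F}}"
      then have J: "J \<noteq> {}" "J \<subseteq> {1..card F}" "finite J"
        by (auto dest: finite_subset)
      have "inj_on h J"
        using h J(2) by (auto simp: bij_betw_def intro: inj_on_subset)
      moreover have "\<Inter>(h ` J) = ext (BigConj \<phi> J)"
        using J \<phi>(2) by (simp add: ext_def ext_pos_BigConj subset_iff)
      moreover have "BigConj \<phi> J \<in> L_BD Prop"
        using J \<phi>(1) by (intro BigConj_in_L_BD) auto
      ultimately show "(-1) ^ (card (h ` J) + 1) * f (\<Inter>(h ` J)) =
          (-1) ^ (card J + 1) * bel (BigConj \<phi> J)"
        by (simp add: card_image f_ext)
    qed
    also have "\<dots> \<le> bel (BigDisj \<phi> {1..card F})"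
      using k(1) \<phi>(1) by (rule bel_total)
    also have "\<dots> = f (ext (BigDisj \<phi> {1..card F}))"
      using k(2) \<phi>(1) by (intro f_ext[symmetric] BigDisj_in_L_BD) auto
    also have "ext (BigDisj \<phi> {1..card F}) = (\<Union>i\<in>{1..card F}. ext (\<phi> i))"
      unfolding ext_def using k(2) by (intro ext_pos_BigDisj) auto
    also have "\<dots> = (\<Union>i\<in>{1..card F}. h i)"
      using \<phi>(2) by simp
    also have "\<dots> = \<Union>F"
      using h by (simp add: bij_betw_def)
    finally show ?thesis .
  qed
  obtain m where m_nonneg: "\<And>U. U \<in> L \<Longrightarrow> m U \<ge> 0"
    and m_sum: "\<And>U. U \<in> L \<Longrightarrow> f U = (\<Sum>V | V \<in> L \<and> V \<subseteq> U. m V)"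
    using totally_monotone_nonneg_mass[of L f, OF finL Int Un f_nonneg f_mono f_total] by blast
  have m_le_1: "sum m L \<le> 1"
  proof (cases "L = {}")
    \<comment> \<open>If there are no formulas, all mass goes to \<open>S\<close>. Otherwise
      \<open>L\<close> has a greatest element, and the total mass is the value of \<open>f\<close>
      there, at most 1.\<close>
    case False
    have top: "\<Union>L \<in> L"
      using finL False Un by (intro Union_closed) auto
    have "{V \<in> L. V \<subseteq> \<Union>L} = L" by blast
    then show ?thesis
      using m_sum[OF top] f_range[OF top] by simp
  qed simp
  define m' where "m' = m(S := 1 - sum m L)"
  define bel' where "bel' A = (\<Sum>V | V \<in> insert S L \<and> V \<subseteq> A. m' V)" for A
  have m'_L: "sum m' X = sum m X" if "X \<subseteq> L" for X
    using that L(3) by (intro sum.cong) (auto simp: m'_def)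
  have "belief_function S bel'"
    unfolding bel'_def
  proof (rule belief_function_mass)
    show "sum m' (insert S L) = 1"
      using finL L(3) m'_L[of L] by (simp add: m'_def)
    show "m' V \<ge> 0" if "V \<in> insert S L" for V
      using that m_nonneg m_le_1 by (auto simp: m'_def)
  \<comment> \<open>\<open>S\<close> is a powerset and so nonempty; therefore \<open>{}\<close> is
    not in \<open>insert S L\<close>.\<close>
  qed (use finL L S in auto)
  moreover have "bel \<phi> = bel' (ext \<phi>)" if \<phi>: "\<phi> \<in> L_BD Prop" for \<phi>
  proof -
    have U: "ext \<phi> \<in> L"
      using \<phi> by (simp add: L_def)
    \<comment> \<open>The extra mass on \<open>S\<close> does not count below an extension, since
      these are proper subsets of \<open>S\<close>.\<close>
    then have "\<not> S \<subseteq> ext \<phi>"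
      using L by (metis PowD subset_antisym subsetD)
    then have "bel' (ext \<phi>) = (\<Sum>V | V \<in> L \<and> V \<subseteq> ext \<phi>. m' V)"
      unfolding bel'_def by (intro sum.cong) auto
    also have "\<dots> = f (ext \<phi>)"
      using m_sum[OF U] m'_L[of "{V \<in> L. V \<subseteq> ext \<phi>}"] by simp
    finally show ?thesis
      using f_ext[OF \<phi>] by simp
  qed
  ultimately show ?thesis
    unfolding S_def ext_def by blast
qed

end
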